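(* Let $Y$ be a finite-dimensional real Banach space, let $C\subseteq Y$ be a closed set such that $Y\setminus C$ is convex, and let $\psi:Y\to Y$ be a continuous function such that $\psi^{-1}(C)$ is non-empty and compact. Assume also that, for each $x\in Y$, there exists $\lambda\in\mathbb{R}$ such that $$\psi(x)+\lambda x\in Y\setminus C.$$ Then there exist $x^*\in\psi^{-1}(C)$ and $\mu^*\in\mathbb{R}$ such that $$\psi(x^* )+(1+\mu^* )x^*\in\partial C$$ and $$\sup_{\|x-x^*\|\leq r}\|\psi(x)-\psi(x^* )+\mu^*(x-x^* )\|\geq r$$ for each $r>0$ small enough (that is, there is $r_0>0$ such that the inequality holds for all $r\in(0,r_0]$).
   Context: $\partial$ denotes the topological boundary in $Y$. *)

theory Defs
  imports "HOL-Analysis.Analysis"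
begin

end

theory Submission
  imports Defs
begin

text \<open>
  Let \<open>U\<close> be the open convex complement of \<open>C\<close>, and for each \<open>x\<close> let \<open>I x\<close> be the open interval
  of all \<open>l\<close> with \<open>\<psi> x + l x \<in> U\<close>. If \<open>\<psi> x \<in> C\<close> then \<open>0 \<notin> I x\<close>, so \<open>I x\<close> lies on one side of
  \<open>0\<close>; replacing \<open>\<psi>\<close> by \<open>x \<mapsto> \<psi> (- x)\<close> if necessary, some \<open>I x\<close> with \<open>\<psi> x \<in> C\<close> is positive.
  On the compact set of those \<open>x\<close> the upper semicontinuous function \<open>Inf (I x)\<close> attains its maximum
  \<open>\<nu>\<close> at some \<open>x1\<close>. By maximality and convexity, \<open>\<psi> x + \<nu> x\<close> lies in the closure of \<open>U\<close> for all
  \<open>x\<close> near \<open>x1\<close>, while \<open>\<psi> x1 + \<nu> x1\<close> is a boundary point of \<open>U\<close>, hence not interior to that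
  closure. Put \<open>\<phi> x = \<psi> x + (\<nu> - 1) x\<close>. If the supremum of \<open>norm (\<phi> x - \<phi> x1)\<close> over the ball of
  radius \<open>r\<close> were less than \<open>r\<close>, Brouwer's theorem applied to \<open>x \<mapsto> y - \<phi> x\<close> would solve
  \<open>\<phi> x + x = y\<close> in the ball for every \<open>y\<close> near \<open>\<phi> x1 + x1 = \<psi> x1 + \<nu> x1\<close>, a contradiction.
\<close>

section \<open>Coordinates and compactness in finite dimension\<close>

text \<open>Tychonoff's theorem. Sequences stand in for coordinate vectors, so that the dimension
  may be an ordinary number \<open>n\<close>.\<close>

lemma compact_box_fun:
  "compact {a :: nat \<Rightarrow> real. \<forall>i. l i \<le> a i \<and> a i \<le> u i}"
proof -
  have "compactin (product_topology (\<lambda>i. euclidean) UNIV) (PiE UNIV (\<lambda>i. {l i..u i}))"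
    by (simp add: compactin_PiE)
  moreover have "PiE UNIV (\<lambda>i. {l i..u i}) = {a. \<forall>i. l i \<le> a i \<and> a i \<le> u i}"
    by (auto simp: PiE_iff)
  ultimately show ?thesis
    by (simp add: euclidean_product_topology)
qed

lemma tendsto_funI:
  fixes f :: "'b \<Rightarrow> 'i \<Rightarrow> 'a::topological_space"
  assumes "\<And>i. ((\<lambda>x. f x i) \<longlongrightarrow> l i) F"
  shows "(f \<longlongrightarrow> l) F"
  using assms limitin_componentwise[of "\<lambda>_. euclidean" "UNIV :: 'i set" f l F]
  by (simp add: euclidean_product_topology)

lemma continuous_on_lincomb:
  fixes b :: "nat \<Rightarrow> 'a::real_normed_vector"
  shows "continuous_on S (\<lambda>a::nat \<Rightarrow> real. \<Sum>i<n. a i *\<^sub>R b i)"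
  by (intro continuous_intros continuous_on_coordinatewise_then_product
        continuous_on_product_coordinates[THEN continuous_on_subset]) auto

text \<open>Boundedness of the coordinates is the point: on the compact surface of the cube, where
  the largest coordinate has modulus 1, the norm of the linear combination has a positive minimum
  \<open>m\<close>, and scaling gives the bound \<open>norm y / m\<close>.\<close>

lemma finite_dim_coordinates:
  fixes B :: "'a::real_normed_vector set"
  assumes "finite B" "span B = UNIV"
  obtains n and b :: "nat \<Rightarrow> 'a" and c :: "nat \<Rightarrow> 'a \<Rightarrow> real"
  where "\<And>i. bounded_linear (c i)"
    and "\<And>y. (\<Sum>i<n. c i y *\<^sub>R b i) = y"
proof -
  obtain B' where B': "B' \<subseteq> B" "independent B'" "B \<subseteq> span B'"
    using maximal_independent_subset[of B] by metis
  have fin: "finite B'" using B' assms finite_subset by blast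
  have sp: "span B' = UNIV"
    using B'(3) assms(2) by (metis span_mono span_span top.extremum_uniqueI)
  obtain b where b: "bij_betw b {..<card B'} B'"
    using fin ex_bij_betw_nat_finite lessThan_atLeast0 by metis
  define n where "n = card B'"
  define c where "c i y = representation B' y (b i)" for i y
  have lin: "linear (c i)" for i
    unfolding c_def by (rule linearI) (use B' sp in \<open>auto simp: representation_add representation_scale\<close>)
  have rec: "(\<Sum>i<n. c i y *\<^sub>R b i) = y" for y
  proof -
    have "(\<Sum>i<n. c i y *\<^sub>R b i) = (\<Sum>v\<in>B'. representation B' y v *\<^sub>R v)"
      unfolding c_def n_def by (rule sum.reindex_bij_betw[OF b, of "\<lambda>v. representation B' y v *\<^sub>R v"])
    also have "\<dots> = y"
      by (rule sum_representation_eq) (use B' sp fin in auto)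
    finally show ?thesis .
  qed
  have coord: "c i (\<Sum>j<n. a j *\<^sub>R b j) = a i" if "i < n" for a i
  proof -
    have "c i (b j) = (if j = i then 1 else 0)" if "j < n" for j
    proof -
      have "b j \<in> B'" using b that by (auto simp: n_def bij_betw_def)
      moreover have "b j = b i \<longleftrightarrow> j = i"
        using b that \<open>i < n\<close> by (auto simp: n_def bij_betw_def inj_on_def)
      ultimately show ?thesis
        using B' by (auto simp: c_def representation_basis)
    qed
    then have "c i (\<Sum>j<n. a j *\<^sub>R b j) = (\<Sum>j<n. if j = i then a j else 0)"
      unfolding linear_sum[OF lin] by (intro sum.cong) (auto simp: linear_scale[OF lin])
    then show ?thesis using that by simp
  qed
  define T where "T a = (\<Sum>i<n. a i *\<^sub>R b i)" for a :: "nat \<Rightarrow> real"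
  \<comment> \<open>Entries from \<open>n\<close> on are pinned to 0, so \<open>S\<close> is the
    cube of side 2 and \<open>S1\<close> its surface.\<close>
  define S where "S = {a :: nat \<Rightarrow> real. \<forall>i. (if i < n then -1 else 0) \<le> a i \<and> a i \<le> (if i < n then 1 else 0)}"
  define S1 where "S1 = S \<inter> (\<Union>i<n. {a. \<bar>a i\<bar> = 1})"
  have "closed {a::nat \<Rightarrow> real. \<bar>a i\<bar> = 1}" for i
    by (intro closed_Collect_eq continuous_intros) auto
  then have "compact S1"
    unfolding S1_def S_def by (intro compact_Int_closed compact_box_fun closed_UN) auto
  moreover have "continuous_on S1 (\<lambda>a. norm (T a))"
    unfolding T_def by (intro continuous_intros continuous_on_lincomb)
  moreover have T0: "norm (T a) > 0" if a: "a \<in> S1" for a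
  proof -
    obtain i where i: "i < n" "\<bar>a i\<bar> = 1" using a S1_def by auto
    have "c i (T a) = a i" unfolding T_def using i coord by blast
    then have "T a \<noteq> 0" using i linear_0[OF lin, of i] by auto
    then show ?thesis by simp
  qed
  ultimately obtain m where m: "m > 0" "\<And>a. a \<in> S1 \<Longrightarrow> m \<le> norm (T a)"
  proof (cases "S1 = {}")
    \<comment> \<open>This is the case \<open>n = 0\<close>, where any positive \<open>m\<close>
      will do.\<close>
    case True
    then show ?thesis using that[of 1] by auto
  next
    case False
    then obtain a where "a \<in> S1" "\<forall>a'\<in>S1. norm (T a) \<le> norm (T a')"
      using continuous_attains_inf[OF \<open>compact S1\<close> _ \<open>continuous_on S1 _\<close>] by blast
    then show ?thesis using that[of "norm (T a)"] T0 by auto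
  qed
  have bnd: "\<bar>c i y\<bar> \<le> norm y * (1 / m)" if "i < n" for i y
  proof -
    define M where "M = Max ((\<lambda>j. \<bar>c j y\<bar>) ` {..<n})"
    have Mge: "\<bar>c j y\<bar> \<le> M" if "j < n" for j
      unfolding M_def using that by (intro Max_ge) auto
    have "M \<in> (\<lambda>j. \<bar>c j y\<bar>) ` {..<n}"
      unfolding M_def using that by (intro Max_in) auto
    then obtain k where k: "k < n" "M = \<bar>c k y\<bar>" by auto
    have "M * m \<le> norm y"
    proof (cases "M = 0")
      case False
      then have M: "M > 0" using k by auto
      \<comment> \<open>Dividing by the largest coordinate moves \<open>y\<close> onto the image of
        \<open>S1\<close>.\<close>
      define a where "a j = (if j < n then c j y / M else 0)" for j
      have "\<bar>a j\<bar> \<le> (if j < n then 1 else 0)" for j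
        using Mge M by (auto simp: a_def field_simps)
      then have "(if j < n then -1 else 0) \<le> a j \<and> a j \<le> (if j < n then 1 else 0)" for j
        by (smt (verit))
      then have "a \<in> S" by (simp add: S_def)
      then have "a \<in> S1"
        using k M by (auto simp: S1_def a_def intro!: bexI[of _ k])
      moreover have "T a = (1 / M) *\<^sub>R y"
      proof -
        have "T a = (\<Sum>i<n. (1 / M) *\<^sub>R (c i y *\<^sub>R b i))"
          unfolding T_def by (intro sum.cong) (auto simp: a_def)
        then show ?thesis unfolding scaleR_sum_right[symmetric] rec .
      qed
      ultimately show ?thesis using m(2)[of a] M by (simp add: field_simps)
    qed auto
    then show ?thesis using Mge[OF that] m(1)
      by (metis (no_types, lifting) mult.right_neutral times_divide_eq_right order_trans pos_le_divide_eq)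
  qed
  show ?thesis
  proof
    \<comment> \<open>The bound is known only for \<open>i < n\<close>, hence the default 0
      elsewhere.\<close>
    show "bounded_linear (\<lambda>y. if i < n then c i y else 0)" for i
    proof (cases "i < n")
      case True
      then show ?thesis using bnd[OF True] lin[of i]
        by (auto intro!: bounded_linear_intro[of _ "1 / m"] simp: linear_add linear_scale)
    qed (simp add: bounded_linear_zero)
    show "(\<Sum>i<n. (if i < n then c i y else 0) *\<^sub>R b i) = y" for y
    proof -
      have "(\<Sum>i<n. (if i < n then c i y else 0) *\<^sub>R b i) = (\<Sum>i<n. c i y *\<^sub>R b i)"
        by (intro sum.cong) auto
      then show ?thesis by (simp only: rec)
    qed
  qed
qed

text \<open>Bounded coordinates place the ball, a closed set, inside the continuous image of a
  compact box.\<close>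

lemma compact_cball_finite_dim:
  fixes x :: "'a::real_normed_vector"
  assumes "\<exists>B::'a set. finite B \<and> span B = UNIV"
  shows "compact (cball x r)"
proof -
  obtain n and b :: "nat \<Rightarrow> 'a" and c :: "nat \<Rightarrow> 'a \<Rightarrow> real"
    where c: "\<And>i. bounded_linear (c i)" "\<And>y. (\<Sum>i<n. c i y *\<^sub>R b i) = y"
    using finite_dim_coordinates assms by metis
  have "\<exists>R. \<forall>y\<in>cball x r. \<bar>c i y\<bar> \<le> R" for i
    using bounded_linear_image[OF bounded_cball c(1)[of i], of x r] unfolding bounded_iff
    by auto
  then obtain R where R: "\<And>i y. y \<in> cball x r \<Longrightarrow> \<bar>c i y\<bar> \<le> R i" by metis
  define S where "S = {a :: nat \<Rightarrow> real. \<forall>i. - R i \<le> a i \<and> a i \<le> R i}"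
  have "compact ((\<lambda>a. \<Sum>i<n. a i *\<^sub>R b i) ` S)"
    unfolding S_def by (intro compact_continuous_image continuous_on_lincomb compact_box_fun)
  moreover have "cball x r \<subseteq> (\<lambda>a. \<Sum>i<n. a i *\<^sub>R b i) ` S"
  proof
    fix y assume "y \<in> cball x r"
    then have "- R i \<le> c i y \<and> c i y \<le> R i" for i using R[of y i] by (simp add: abs_le_iff minus_le_iff)
    then have "(\<lambda>i. c i y) \<in> S" by (simp add: S_def)
    then show "y \<in> (\<lambda>a. \<Sum>i<n. a i *\<^sub>R b i) ` S" 
      by (rule image_eqI[rotated]) (simp only: c(2))
  qed
  ultimately show ?thesis
    using compact_Int_closed[OF _ closed_cball, of _ x r] by (metis inf.absorb2)
qed

section \<open>Brouwer's fixed point theorem\<close>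

text \<open>
  The library states Brouwer's theorem for the class \<open>euclidean_space\<close> only, and a normed space with
  a finite spanning set cannot be transferred to such a type. The cube version is therefore derived
  again from Kuhn's lemma, with points of the cube encoded as sequences of which only the first
  \<open>n\<close> entries matter.
\<close>

lemma brouwer_unit_cube_fun:
  fixes F :: "(nat \<Rightarrow> real) \<Rightarrow> nat \<Rightarrow> real"
  assumes cont: "\<And>i. i < n \<Longrightarrow> continuous_on UNIV (\<lambda>a. F a i)"
    and F: "\<And>a i. i < n \<Longrightarrow> F a i \<in> {0..1}"
  shows "\<exists>a. \<forall>i<n. F a i = a i"
proof -
  define S where "S = {a :: nat \<Rightarrow> real. \<forall>i. 0 \<le> a i \<and> a i \<le> (if i < n then 1 else 0)}"
  define pt where "pt p q = (\<lambda>i. if i < n then real (q i) / real p else 0)" for p and q :: "nat \<Rightarrow> nat"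
  \<comment> \<open>Label 0 records that \<open>F\<close> does not decrease coordinate
    \<open>i\<close>, label 1 that it does not increase it. The labels forced on the faces by Kuhn's
    lemma agree with this because \<open>F\<close> stays in the unit interval.\<close>
  define lab where "lab p q i =
      (if q i = 0 then 0 else if q i = p then 1 else if pt p q i \<le> F (pt p q) i then 0 else 1::nat)"
    for p q i
  have lab0: "pt p q i \<le> F (pt p q) i" if "lab p q i = 0" "i < n" for p q i
    using that F[of i "pt p q"] by (auto simp: lab_def pt_def split: if_splits)
  have lab1: "F (pt p q) i \<le> pt p q i" if "lab p q i \<noteq> 0" "i < n" "p > 0" for p q i
    using that F[of i "pt p q"] by (auto simp: lab_def pt_def split: if_splits)
  \<comment> \<open>\<open>w\<close> is a corner of the grid cell with lowest corner
    \<open>q\<close>.\<close>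
  define adj where "adj q w \<longleftrightarrow> (\<forall>j<n. q j \<le> w j \<and> w j \<le> q j + 1)" for q w :: "nat \<Rightarrow> nat"
  have "\<exists>q. (\<forall>i<n. q i < p) \<and>
            (\<forall>i<n. \<exists>r s. adj q r \<and> adj q s \<and> lab p r i = 0 \<and> lab p s i \<noteq> 0)" if "p > 0" for p
  proof -
    obtain q where q1: "\<forall>i<n. q i < p"
      and q2: "\<forall>i<n. \<exists>r s. adj q r \<and> adj q s \<and> lab p r i \<noteq> lab p s i"
      unfolding adj_def
      by (rule kuhn_lemma[of p n "lab p"]) (use \<open>p > 0\<close> in \<open>auto simp: lab_def\<close>)
    have "\<exists>r s. adj q r \<and> adj q s \<and> lab p r i = 0 \<and> lab p s i \<noteq> 0" if i: "i < n" for i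
    proof -
      obtain r s where rs: "adj q r" "adj q s" "lab p r i \<noteq> lab p s i" using q2 i by blast
      moreover have "lab p r i \<in> {0, 1}" "lab p s i \<in> {0, 1}" by (auto simp: lab_def)
      ultimately have "lab p r i = 0 \<and> lab p s i \<noteq> 0 \<or> lab p s i = 0 \<and> lab p r i \<noteq> 0" by auto
      then show ?thesis using rs by blast
    qed
    then show ?thesis using q1 by blast
  qed
  then have "\<forall>k. \<exists>q. (\<forall>i<n. q i < Suc k) \<and>
      (\<forall>i<n. \<exists>r s. adj q r \<and> adj q s \<and> lab (Suc k) r i = 0 \<and> lab (Suc k) s i \<noteq> 0)"
    by blast
  then obtain q where q: "\<And>k i. i < n \<Longrightarrow> q k i < Suc k"
     and "\<forall>k. \<forall>i<n. \<exists>r s. adj (q k) r \<and> adj (q k) s \<and> lab (Suc k) r i = 0 \<and> lab (Suc k) s i \<noteq> 0"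
    by metis
  then obtain r s where
       r: "\<And>k i. i < n \<Longrightarrow> adj (q k) (r k i)" and s: "\<And>k i. i < n \<Longrightarrow> adj (q k) (s k i)"
     and r0: "\<And>k i. i < n \<Longrightarrow> lab (Suc k) (r k i) i = 0"
     and s1: "\<And>k i. i < n \<Longrightarrow> lab (Suc k) (s k i) i \<noteq> 0"
    by metis
  have "pt (Suc k) (q k) \<in> S" for k
    using q[of _ k] by (force simp: S_def pt_def divide_le_eq_1)
  moreover have "compact S"
    unfolding S_def by (rule compact_box_fun)
  ultimately obtain z \<rho> where z: "strict_mono \<rho>" "((\<lambda>k. pt (Suc k) (q k)) \<circ> \<rho>) \<longlonglongrightarrow> z"
    using seq_compactE[OF compact_imp_seq_compact] by (metis (no_types, lifting))
  \<comment> \<open>Cells shrink with the mesh, so any choice of corners has the same limit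
    \<open>z\<close>.\<close>
  have near: "(\<lambda>k. pt (Suc (\<rho> k)) (w (\<rho> k))) \<longlonglongrightarrow> z"
    if w: "\<And>k. adj (q k) (w k)" for w
  proof -
    have "(\<lambda>k. pt (Suc (\<rho> k)) (w (\<rho> k)) j) \<longlonglongrightarrow> z j" for j
    proof -
      have lim: "(\<lambda>k. pt (Suc (\<rho> k)) (q (\<rho> k)) j) \<longlonglongrightarrow> z j"
        using continuous_on_tendsto_compose[OF continuous_on_product_coordinates[of j] z(2)]
        by (simp add: o_def)
      have "(\<lambda>k. inverse (real (Suc (\<rho> k)))) \<longlonglongrightarrow> 0"
        using LIMSEQ_subseq_LIMSEQ[OF LIMSEQ_inverse_real_of_nat z(1)] by (simp add: o_def)
      then have lim': "(\<lambda>k. pt (Suc (\<rho> k)) (q (\<rho> k)) j + inverse (real (Suc (\<rho> k)))) \<longlonglongrightarrow> z j"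
        using tendsto_add[OF lim] by fastforce
      have 1: "pt (Suc (\<rho> k)) (q (\<rho> k)) j \<le> pt (Suc (\<rho> k)) (w (\<rho> k)) j" for k
        using w[of "\<rho> k"] by (auto simp: pt_def adj_def divide_right_mono)
      have 2: "pt (Suc (\<rho> k)) (w (\<rho> k)) j \<le> pt (Suc (\<rho> k)) (q (\<rho> k)) j + inverse (real (Suc (\<rho> k)))" for k
      proof (cases "j < n")
        case True
        then have "real (w (\<rho> k) j) \<le> real (q (\<rho> k) j) + 1"
          using w[of "\<rho> k"] by (force simp: adj_def)
        then have "real (w (\<rho> k) j) / real (Suc (\<rho> k)) \<le> (real (q (\<rho> k) j) + 1) / real (Suc (\<rho> k))"
          by (intro divide_right_mono) auto
        then show ?thesis using True by (simp add: pt_def add_divide_distrib inverse_eq_divide)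
      qed (simp add: pt_def)
      show ?thesis
        by (rule tendsto_sandwich[OF _ _ lim lim']) (use 1 2 in auto)
    qed
    then show ?thesis by (rule tendsto_funI)
  qed
  \<comment> \<open>Corners labelled 0 give one inequality in the limit, the others the reverse
    one.\<close>
  have "F z i = z i" if i: "i < n" for i
  proof (rule antisym)
    have "continuous_on UNIV (\<lambda>a::nat \<Rightarrow> real. a i - F a i)"
      using cont[OF i] by (intro continuous_intros) auto
    then have lim: "(\<lambda>k. u k i - F (u k) i) \<longlonglongrightarrow> z i - F z i" if "u \<longlonglongrightarrow> z" for u
      using continuous_on_tendsto_compose[OF _ that] by fastforce
    have "z i - F z i \<le> 0"
      using lim[OF near[of "\<lambda>k. r k i"]] r[OF i] lab0[OF r0[OF i] i]
      by (intro LIMSEQ_le_const2) auto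
    then show "z i \<le> F z i" by simp
    have "0 \<le> z i - F z i"
      using lim[OF near[of "\<lambda>k. s k i"]] s[OF i] lab1[OF s1[OF i] i]
      by (intro LIMSEQ_le_const) auto
    then show "F z i \<le> z i" by simp
  qed
  then show ?thesis by auto
qed

text \<open>The cube theorem is applied to \<open>f\<close> composed with the retraction
  \<open>\<rho>\<close>, written in rescaled coordinates. A fixed point is a value of
  \<open>f\<close>, so it lies in the ball, where \<open>\<rho>\<close> is the identity.\<close>

lemma brouwer_cball_finite_dim:
  fixes f :: "'a::real_normed_vector \<Rightarrow> 'a"
  assumes fd: "\<exists>B::'a set. finite B \<and> span B = UNIV"
    and "r > 0" and cont: "continuous_on (cball x r) f" and f: "f ` cball x r \<subseteq> cball x r"
  shows "\<exists>y\<in>cball x r. f y = y"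
proof -
  obtain n and b :: "nat \<Rightarrow> 'a" and c :: "nat \<Rightarrow> 'a \<Rightarrow> real"
    where c: "\<And>i. bounded_linear (c i)" "\<And>y. (\<Sum>i<n. c i y *\<^sub>R b i) = y"
    using finite_dim_coordinates fd by metis
  have "\<exists>R>0. \<forall>y\<in>cball x r. \<bar>c i y\<bar> \<le> R" for i
    using bounded_linear_image[OF bounded_cball c(1)[of i], of x r] unfolding bounded_pos
    by auto
  then obtain R where R: "\<And>i. R i > 0" "\<And>i y. y \<in> cball x r \<Longrightarrow> \<bar>c i y\<bar> \<le> R i" by metis
  \<comment> \<open>radial retraction onto the ball\<close>
  define \<rho> where "\<rho> y = x + (r / max r (norm (y - x))) *\<^sub>R (y - x)" for y
  have "continuous_on UNIV \<rho>"
    unfolding \<rho>_def using \<open>r > 0\<close> by (intro continuous_intros) auto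
  have "\<rho> y \<in> cball x r" for y
  proof -
    have "norm (y - x) * r \<le> r * max r (norm (y - x))" using \<open>r > 0\<close> by (simp add: mult.commute)
    then show ?thesis using \<open>r > 0\<close> by (simp add: \<rho>_def dist_norm divide_simps mult.commute)
  qed
  then have f\<rho>: "f (\<rho> y) \<in> cball x r" for y using f by blast
  have contf\<rho>: "continuous_on UNIV (\<lambda>y. f (\<rho> y))"
    by (rule continuous_on_compose2[OF cont \<open>continuous_on UNIV \<rho>\<close>]) (use \<open>\<And>y. \<rho> y \<in> _\<close> in auto)
  \<comment> \<open>An affine chart taking the unit cube to the box with half-widths
    \<open>R i\<close>, which contains the coordinates of the ball.\<close>
  define P where "P a = (\<Sum>i<n. (R i * (2 * a i - 1)) *\<^sub>R b i)" for a :: "nat \<Rightarrow> real"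
  have contP: "continuous_on UNIV P"
    unfolding P_def by (intro continuous_intros) auto
  have cont': "continuous_on UNIV (\<lambda>a. f (\<rho> (P a)))"
    by (rule continuous_on_compose2[OF contf\<rho> contP]) auto
  then have "\<exists>a. \<forall>i<n. (c i (f (\<rho> (P a))) / R i + 1) / 2 = a i"
  using cont'
  proof (intro brouwer_unit_cube_fun)
    fix a :: "nat \<Rightarrow> real" and i
    show "(c i (f (\<rho> (P a))) / R i + 1) / 2 \<in> {0..1}"
      using R(1)[of i] R(2)[OF f\<rho>, of i "P a"] by (simp add: field_simps abs_le_iff)
  qed (use R(1) in \<open>auto intro!: continuous_intros bounded_linear.continuous_on[OF c(1)] simp: less_imp_neq[symmetric]\<close>)
  then obtain a where "\<forall>i<n. (c i (f (\<rho> (P a))) / R i + 1) / 2 = a i" by auto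
  then have "c i (f (\<rho> (P a))) = R i * (2 * a i - 1)" if "i < n" for i
    using that R(1)[of i] by (auto simp: field_simps)
  then have eq: "f (\<rho> (P a)) = P a"
    using c(2)[of "f (\<rho> (P a))"] by (simp add: P_def)
  then have "P a \<in> cball x r" using f\<rho>[of "P a"] by simp
  then have "\<rho> (P a) = P a"
    using \<open>r > 0\<close> by (simp add: \<rho>_def dist_norm norm_minus_commute max_absorb1)
  then show ?thesis using eq \<open>P a \<in> cball x r\<close> by auto
qed

section \<open>Open convex sets and semicontinuous maxima\<close>

lemma interior_closure_convex_open_subset:
  fixes U :: "'a::real_normed_vector set"
  assumes "open U" "convex U"
  shows "interior (closure U) \<subseteq> U"
proof
  fix y assume "y \<in> interior (closure U)"
  then obtain e where e: "e > 0" "ball y e \<subseteq> closure U"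
    by (meson mem_interior)
  then have "y \<in> closure U" by auto
  then obtain u where u: "u \<in> U" by (metis closure_empty all_not_in_conv)
  \<comment> \<open>Small enough that \<open>w\<close>, beyond \<open>y\<close> on the ray from
    \<open>u\<close>, stays in the ball; the \<open>+ 1\<close> covers \<open>y = u\<close>.\<close>
  define d where "d = e / (2 * (norm (y - u) + 1))"
  have pos: "2 * (norm (y - u) + 1) > 0"
    by (smt (verit) norm_ge_zero)
  then have d: "d > 0" using e by (simp add: d_def)
  have "d * norm (y - u) < e"
  proof -
    have "e * norm (y - u) < e * (2 * (norm (y - u) + 1))"
      using e by (intro mult_strict_left_mono) (smt (verit) norm_ge_zero)+
    then show ?thesis using pos by (simp add: d_def pos_divide_less_eq)
  qed
  define w where "w = y + d *\<^sub>R (y - u)"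
  have "w \<in> closure U"
    using e(2) \<open>d * norm (y - u) < e\<close> d by (auto simp: w_def dist_norm)
  \<comment> \<open>\<open>h v\<close> is chosen so that \<open>y\<close> is a convex combination of
    \<open>v\<close> and \<open>h v\<close>. As \<open>h w = u\<close>, continuity keeps
    \<open>h v\<close> in \<open>U\<close> for \<open>v\<close> near \<open>w\<close>, and some such
    \<open>v\<close> lies in \<open>U\<close>.\<close>
  define h where "h v = (1 + 1 / d) *\<^sub>R y - (1 / d) *\<^sub>R v" for v
  have "open (h -` U)"
    unfolding h_def using \<open>open U\<close> by (intro open_vimage continuous_intros)
  moreover have "h w = u"
    using d by (simp add: h_def w_def algebra_simps)
  ultimately obtain v where v: "v \<in> U" "h v \<in> U"
    using \<open>w \<in> closure U\<close> u open_Int_closure_eq_empty[of "h -` U" U] by blast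
  have "y = (1 / (1 + d)) *\<^sub>R v + (d / (1 + d)) *\<^sub>R h v"
  proof -
    have "(1 + d) *\<^sub>R y = v + d *\<^sub>R h v"
      using d by (simp add: h_def algebra_simps)
    then have "y = (1 / (1 + d)) *\<^sub>R (v + d *\<^sub>R h v)"
      using d by (metis add_pos_pos less_numeral_extra(1) less_irrefl nonzero_divide_eq_eq
          scaleR_one scaleR_scaleR)
    then show ?thesis by (simp add: algebra_simps)
  qed
  then show "y \<in> U"
    using convexD[OF \<open>convex U\<close> v, of "1 / (1 + d)" "d / (1 + d)"] d
    by (simp add: add_divide_distrib[symmetric])
qed

text \<open>Without a maximum the sets \<open>f x < f y\<close> would cover \<open>S\<close>; in a
  finite subcover, the \<open>y\<close> with the largest value escapes every set.\<close>

lemma usc_attains_sup: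
  fixes f :: "'a::topological_space \<Rightarrow> 'b::linorder"
  assumes "compact S" "S \<noteq> {}" "\<And>c. openin (top_of_set S) {x\<in>S. f x < c}"
  shows "\<exists>x\<in>S. \<forall>y\<in>S. f y \<le> f x"
proof (rule ccontr)
  assume "\<not> ?thesis"
  then have "\<forall>x\<in>S. \<exists>y\<in>S. f x < f y" by (auto simp: not_le)
  then have "S \<subseteq> \<Union> ((\<lambda>y. {x\<in>S. f x < f y}) ` S)" by auto
  moreover have "\<forall>A\<in>(\<lambda>y. {x\<in>S. f x < f y}) ` S. openin (top_of_set S) A"
    using assms(3) by auto
  ultimately obtain D where D: "D \<subseteq> (\<lambda>y. {x\<in>S. f x < f y}) ` S" "finite D" "S \<subseteq> \<Union>D"
    using assms(1) unfolding compact_eq_openin_cover by meson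
  then obtain A where A: "A \<subseteq> S" "finite A" "D = (\<lambda>y. {x\<in>S. f x < f y}) ` A"
    by (meson finite_subset_image)
  have "A \<noteq> {}" using A D \<open>S \<noteq> {}\<close> by auto
  then have "Max (f ` A) \<in> f ` A" using A by (intro Max_in) auto
  then obtain y where y: "y \<in> A" "f y = Max (f ` A)" by auto
  then obtain y' where "y' \<in> A" "f y < f y'" using A D by blast
  then show False using y A by (metis Max_ge finite_imageI image_eqI leD)
qed

section \<open>The extremal parameter\<close>

lemma local_one_sided_contact:
  fixes \<psi> :: "'a::real_normed_vector \<Rightarrow> 'a"
  assumes "open U" "convex U" and cont: "continuous_on UNIV \<psi>"
    and "compact (\<psi> -` (- U))"
    and ex: "\<And>x. \<exists>l::real. \<psi> x + l *\<^sub>R x \<in> U"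
    and x0: "\<psi> x0 \<notin> U" "\<psi> x0 + l0 *\<^sub>R x0 \<in> U" "l0 > 0"
  shows "\<exists>x1 \<nu>. \<psi> x1 \<notin> U \<and> \<psi> x1 + \<nu> *\<^sub>R x1 \<notin> U \<and>
           (\<exists>r0>0. \<forall>x\<in>cball x1 r0. \<psi> x + \<nu> *\<^sub>R x \<in> closure U)"
proof -
  define I where "I x = {l. \<psi> x + l *\<^sub>R x \<in> U}" for x
  have openl: "open {x. l \<in> I x}" for l
  proof -
    have "open ((\<lambda>x. \<psi> x + l *\<^sub>R x) -` U)"
      using cont \<open>open U\<close> by (intro open_vimage continuous_intros)
    then show ?thesis by (simp add: I_def vimage_def)
  qed
  have openI: "open (I x)" for x
  proof -
    have "open ((\<lambda>l. \<psi> x + l *\<^sub>R x) -` U)"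
      using \<open>open U\<close> by (intro open_vimage continuous_intros)
    then show ?thesis by (simp add: I_def vimage_def)
  qed
  have between: "m \<in> I x" if "l \<in> I x" "u \<in> I x" "l \<le> m" "m \<le> u" for l m u x
  proof -
    have "convex (I x)"
    proof (rule convexI)
      fix s t a b :: real assume *: "s \<in> I x" "t \<in> I x" "0 \<le> a" "0 \<le> b" "a + b = 1"
      have "\<psi> x + (a *\<^sub>R s + b *\<^sub>R t) *\<^sub>R x = (a + b) *\<^sub>R \<psi> x + (a *\<^sub>R s + b *\<^sub>R t) *\<^sub>R x"
        using * by simp
      also have "\<dots> = a *\<^sub>R (\<psi> x + s *\<^sub>R x) + b *\<^sub>R (\<psi> x + t *\<^sub>R x)"
        by (simp add: algebra_simps)
      also have "\<dots> \<in> U"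
        using * \<open>convex U\<close> by (intro convexD) (auto simp: I_def)
      finally show "a *\<^sub>R s + b *\<^sub>R t \<in> I x" by (simp add: I_def)
    qed
    then show ?thesis using that
      by (meson atLeastAtMost_iff connected_contains_Icc convex_connected subsetD)
  qed
  have I0: "0 \<in> I x \<longleftrightarrow> \<psi> x \<in> U" for x by (simp add: I_def)
  \<comment> \<open>On \<open>\<psi> -` (- U)\<close> excluding negative parameters is the same as admitting a positive one;
      this form makes compactness of \<open>S\<close> evident.\<close>
  define S where "S = \<psi> -` (- U) - (\<Union>l\<in>{..<0}. {x. l \<in> I x})"
  have Spos: "l > 0" if "x \<in> S" "l \<in> I x" for x l
    using that I0[of x] by (cases l "0::real" rule: linorder_cases) (auto simp: S_def)
  have "compact S"
    unfolding S_def using assms(4) openl by (intro compact_diff open_UN) auto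
  moreover have "x0 \<in> S"
  proof -
    have "l0 \<in> I x0" "0 \<notin> I x0" using x0 by (auto simp: I_def)
    then show ?thesis
      using x0 between[of _ x0 l0 0] by (force simp: S_def)
  qed
  moreover have ne: "I x \<noteq> {}" for x using ex by (auto simp: I_def)
  have bdd: "bdd_below (I x)" if "x \<in> S" for x
    using Spos[OF that] by (auto intro!: bdd_belowI[of _ 0] less_imp_le)
  have Inf_less: "Inf (I x) < c \<longleftrightarrow> (\<exists>l\<in>I x. l < c)" if "x \<in> S" for x c
    by (rule cInf_less_iff[OF ne bdd[OF that]])
  \<comment> \<open>Upper semicontinuity: \<open>Inf (I x) < c\<close> means that some
    \<open>l < c\<close> lies in \<open>I x\<close>, and each such condition is open in
    \<open>x\<close>.\<close>
  have "openin (top_of_set S) {x\<in>S. Inf (I x) < c}" for c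
  proof -
    have "{x\<in>S. Inf (I x) < c} = S \<inter> (\<Union>l\<in>{..<c}. {x. l \<in> I x})"
      using Inf_less by auto
    then show ?thesis using openl by (auto intro!: openin_open_Int open_UN)
  qed
  ultimately obtain x1 where x1: "x1 \<in> S" "\<And>x. x \<in> S \<Longrightarrow> Inf (I x) \<le> Inf (I x1)"
    using usc_attains_sup[of S "\<lambda>x. Inf (I x)"] by blast
  define \<nu> where "\<nu> = Inf (I x1)"
  have \<nu>0: "\<nu> \<ge> 0"
    unfolding \<nu>_def using ne Spos[OF x1(1)] by (intro cInf_greatest) (auto intro: less_imp_le)
  have \<nu>le: "\<nu> \<le> l" if "l \<in> I x1" for l
    unfolding \<nu>_def using that bdd[OF x1(1)] by (rule cInf_lower)
  have \<nu>I: "\<nu> \<notin> I x1"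
  proof
    assume "\<nu> \<in> I x1"
    then obtain e where "e > 0" "ball \<nu> e \<subseteq> I x1" using openI by (meson openE)
    then have "\<nu> - e / 2 \<in> I x1" by (auto simp: dist_real_def)
    then show False using \<nu>le \<open>e > 0\<close> by fastforce
  qed
  \<comment> \<open>One \<open>u > \<nu>\<close> serves a whole ball around \<open>x1\<close>, since
    \<open>u \<in> I x\<close> is an open condition on \<open>x\<close>.\<close>
  obtain u where u: "u \<in> I x1" using ne by auto
  then have "\<nu> < u" using \<nu>le \<nu>I by (metis order_le_less)
  obtain r0 where r0: "r0 > 0" "cball x1 r0 \<subseteq> {x. u \<in> I x}"
    using openl[of u] u open_contains_cball by (metis mem_Collect_eq)
  have "\<psi> x + \<nu> *\<^sub>R x \<in> closure U" if x: "x \<in> cball x1 r0" for x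
  proof -
    have ux: "u \<in> I x" using r0 x by auto
    \<comment> \<open>An element of \<open>I x\<close> below \<open>t\<close> suffices: it is 0 if
      \<open>\<psi> x \<in> U\<close>; otherwise \<open>x \<in> S\<close>, and maximality of
      \<open>\<nu>\<close> provides one.\<close>
    have in_I: "t \<in> I x" if t: "\<nu> < t" "t \<le> u" for t
    proof (cases "\<psi> x \<in> U")
      case True
      then show ?thesis using between[of 0 x u t] ux t \<nu>0 I0 by auto
    next
      case False
      then have "x \<in> S"
        using between[of _ x u 0] ux I0[of x] \<open>\<nu> < u\<close> \<nu>0 by (force simp: S_def)
      then obtain l where "l \<in> I x" "l < t"
        using x1(2) Inf_less[of x t] t unfolding \<nu>_def by force
      then show ?thesis using between[of l x u t] ux t by auto
    qed
    have lim: "((\<lambda>t. \<psi> x + t *\<^sub>R x) \<longlongrightarrow> \<psi> x + \<nu> *\<^sub>R x) (at_right \<nu>)"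
      by (intro tendsto_intros)
    have "eventually (\<lambda>t. \<nu> < t \<and> t < u) (at_right \<nu>)"
      unfolding eventually_at_right_field using \<open>\<nu> < u\<close> by blast
    then have "eventually (\<lambda>t. \<psi> x + t *\<^sub>R x \<in> closure U) (at_right \<nu>)"
      by eventually_elim (use in_I closure_subset[of U] in \<open>force simp: I_def\<close>)
    then show ?thesis
      using Lim_in_closed_set[OF closed_closure _ _ lim] by simp
  qed
  moreover have "\<psi> x1 \<notin> U" using x1 by (simp add: S_def)
  ultimately show ?thesis
    using \<nu>I r0(1) by (intro exI[of _ x1] exI[of _ \<nu>] conjI exI[of _ r0]) (auto simp: I_def)
qed

section \<open>From Brouwer's theorem to the oscillation bound\<close>

lemma sup_norm_ge_if_not_interior_image:
  fixes \<phi> :: "'a::real_normed_vector \<Rightarrow> 'a"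
  assumes fd: "\<exists>B::'a set. finite B \<and> span B = UNIV"
    and cont: "continuous_on (cball x1 r) \<phi>" and "r > 0"
    and ni: "\<phi> x1 + x1 \<notin> interior ((\<lambda>x. \<phi> x + x) ` cball x1 r)"
  shows "r \<le> (SUP x\<in>cball x1 r. norm (\<phi> x - \<phi> x1))"
proof (rule ccontr)
  define s where "s = (SUP x\<in>cball x1 r. norm (\<phi> x - \<phi> x1))"
  assume "\<not> ?thesis"
  then have "s < r" by (simp add: s_def)
  have "compact ((\<lambda>x. norm (\<phi> x - \<phi> x1)) ` cball x1 r)"
    using cont by (intro compact_continuous_image compact_cball_finite_dim fd continuous_intros)
  \<comment> \<open>A real supremum bounds its set only if the set is bounded above; compactness of
    the ball ensures this.\<close>
  then have "bdd_above ((\<lambda>x. norm (\<phi> x - \<phi> x1)) ` cball x1 r)"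
    by (intro bounded_imp_bdd_above compact_imp_bounded)
  then have le: "norm (\<phi> x - \<phi> x1) \<le> s" if "x \<in> cball x1 r" for x
    unfolding s_def using that by (rule cSUP_upper[rotated])
  \<comment> \<open>For \<open>y\<close> in this ball, \<open>x1 - (y - \<phi> x)\<close> has norm
    at most \<open>(r - s) + s\<close>, so Brouwer's theorem applies.\<close>
  have "ball (\<phi> x1 + x1) (r - s) \<subseteq> (\<lambda>x. \<phi> x + x) ` cball x1 r"
  proof
    fix y assume y: "y \<in> ball (\<phi> x1 + x1) (r - s)"
    have "\<exists>x\<in>cball x1 r. y - \<phi> x = x"
    proof (rule brouwer_cball_finite_dim[OF fd \<open>r > 0\<close>])
      show "continuous_on (cball x1 r) (\<lambda>x. y - \<phi> x)" using cont by (intro continuous_intros)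
      show "(\<lambda>x. y - \<phi> x) ` cball x1 r \<subseteq> cball x1 r"
      proof clarify
        fix x assume "x \<in> cball x1 r"
        have "x1 - (y - \<phi> x) = (\<phi> x1 + x1 - y) + (\<phi> x - \<phi> x1)" by simp
        then have "norm (x1 - (y - \<phi> x)) \<le> norm (\<phi> x1 + x1 - y) + norm (\<phi> x - \<phi> x1)"
          by (metis norm_triangle_ineq)
        also have "\<dots> \<le> r" using y le[OF \<open>x \<in> _\<close>] by (simp add: dist_norm)
        finally show "y - \<phi> x \<in> cball x1 r" by (simp add: dist_norm)
      qed
    qed
    then obtain x where "x \<in> cball x1 r" "y = \<phi> x + x" by (metis add.commute diff_add_cancel)
    then show "y \<in> (\<lambda>x. \<phi> x + x) ` cball x1 r" by auto
  qed
  then have "\<phi> x1 + x1 \<in> interior ((\<lambda>x. \<phi> x + x) ` cball x1 r)"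
    using \<open>s < r\<close> by (meson mem_interior diff_gt_0_iff_gt)
  then show False using ni by simp
qed

theorem theorem5:
  fixes C :: "'a::banach set" and \<psi> :: "'a \<Rightarrow> 'a"
  assumes "\<exists>B::'a set. finite B \<and> span B = UNIV"
    and "closed C"
    and "convex (UNIV - C)"
    and "continuous_on UNIV \<psi>"
    and "\<psi> -` C \<noteq> {}"
    and "compact (\<psi> -` C)"
    and "\<And>x. \<exists>l::real. \<psi> x + l *\<^sub>R x \<in> UNIV - C"
  shows "\<exists>xs \<in> \<psi> -` C. \<exists>\<mu>::real.
           \<psi> xs + (1 + \<mu>) *\<^sub>R xs \<in> frontier C \<and>
           (\<exists>r0>0. \<forall>r\<in>{0<..r0}.
              (SUP x\<in>{x. norm (x - xs) \<le> r}. norm (\<psi> x - \<psi> xs + \<mu> *\<^sub>R (x - xs))) \<ge> r)"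
proof -
  define U where "U = - C"
  have U: "open U" "convex U" and C: "C = - U"
    using assms(2,3) by (auto simp: U_def Compl_eq_Diff_UNIV open_Compl)
  have ex: "\<exists>l::real. \<psi> x + l *\<^sub>R x \<in> U" for x using assms(7)[of x] by (simp add: C)
  obtain x0 l0 where x0: "\<psi> x0 \<notin> U" "\<psi> x0 + l0 *\<^sub>R x0 \<in> U"
    using assms(5) ex C by blast
  have "\<exists>x1 \<nu>. \<psi> x1 \<notin> U \<and> \<psi> x1 + \<nu> *\<^sub>R x1 \<notin> U \<and>
           (\<exists>r0>0. \<forall>x\<in>cball x1 r0. \<psi> x + \<nu> *\<^sub>R x \<in> closure U)"
  proof (cases "l0 > 0")
    case True
    then show ?thesis
      using local_one_sided_contact[OF U assms(4) _ ex x0] assms(6) C by simp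
  next
    case False
    \<comment> \<open>\<open>l0 = 0\<close> is excluded by \<open>\<psi> x0 \<notin> U\<close>.
      Reflecting \<open>x\<close> then changes the sign of the parameter.\<close>
    then have l0: "- l0 > 0" using x0 by (metis add.right_neutral linorder_neqE_linordered_idom neg_0_less_iff_less scaleR_zero_left)
    have "(\<lambda>x. \<psi> (- x)) -` (- U) = uminus ` (\<psi> -` (- U))"
      by (auto intro: image_eqI[of _ _ "- x" for x])
    moreover have "compact (uminus ` (\<psi> -` (- U)))"
      using assms(6) C by (intro compact_continuous_image continuous_intros) auto
    ultimately have K: "compact ((\<lambda>x. \<psi> (- x)) -` (- U))" by simp
    have cont: "continuous_on UNIV (\<lambda>x. \<psi> (- x))"
      by (rule continuous_on_compose2[OF assms(4)]) (auto intro!: continuous_intros)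
    have ex': "\<exists>l::real. \<psi> (- x) + l *\<^sub>R x \<in> U" for x
    proof -
      obtain l where "\<psi> (- x) + l *\<^sub>R (- x) \<in> U" using ex by blast
      then show ?thesis by (intro exI[of _ "- l"]) simp
    qed
    obtain x1 \<nu> r0 where x1: "\<psi> (- x1) \<notin> U" "\<psi> (- x1) + \<nu> *\<^sub>R x1 \<notin> U" "r0 > 0"
       "\<And>x. x \<in> cball x1 r0 \<Longrightarrow> \<psi> (- x) + \<nu> *\<^sub>R x \<in> closure U"
      using local_one_sided_contact[OF U cont K ex', of "- x0" "- l0"] x0 l0 by auto
    have "\<psi> x + (- \<nu>) *\<^sub>R x \<in> closure U" if "x \<in> cball (- x1) r0" for x
      using x1(4)[of "- x"] that
      by (simp add: dist_norm norm_minus_commute add.commute)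
    then show ?thesis using x1(1-3) by (intro exI[of _ "- x1"] exI[of _ "- \<nu>"]) auto
  qed
  then obtain x1 \<nu> r0 where x1: "\<psi> x1 \<notin> U" "\<psi> x1 + \<nu> *\<^sub>R x1 \<notin> U" "r0 > 0"
       "\<And>x. x \<in> cball x1 r0 \<Longrightarrow> \<psi> x + \<nu> *\<^sub>R x \<in> closure U"
    by blast
  define \<mu> where "\<mu> = \<nu> - 1"
  define \<phi> where "\<phi> x = \<psi> x + \<mu> *\<^sub>R x" for x
  have \<phi>: "\<phi> x + x = \<psi> x + \<nu> *\<^sub>R x" for x
    by (simp add: \<phi>_def \<mu>_def algebra_simps)
  have "\<psi> x1 + (1 + \<mu>) *\<^sub>R x1 \<in> frontier C"
    using x1(2,3) x1(4)[of x1] U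
    unfolding \<mu>_def C frontier_complement by (simp add: frontier_def interior_open)
  moreover have "r \<le> (SUP x\<in>{x. norm (x - x1) \<le> r}. norm (\<psi> x - \<psi> x1 + \<mu> *\<^sub>R (x - x1)))"
    if r: "r \<in> {0<..r0}" for r
  proof -
    have "(\<lambda>x. \<phi> x + x) ` cball x1 r \<subseteq> closure U"
      using x1(4) r by (auto simp: \<phi>)
    \<comment> \<open>An interior point of the image would be interior to \<open>closure U\<close>,
      hence in \<open>U\<close>.\<close>
    then have "\<phi> x1 + x1 \<notin> interior ((\<lambda>x. \<phi> x + x) ` cball x1 r)"
      using interior_closure_convex_open_subset[OF U] interior_mono x1(2) \<phi> by (metis subsetD)
    moreover have "continuous_on (cball x1 r) \<phi>"
      unfolding \<phi>_def using continuous_on_subset[OF assms(4)] by (intro continuous_intros) auto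
    ultimately have "r \<le> (SUP x\<in>cball x1 r. norm (\<phi> x - \<phi> x1))"
      using r by (intro sup_norm_ge_if_not_interior_image[OF assms(1)]) auto
    moreover have "cball x1 r = {x. norm (x - x1) \<le> r}"
      by (auto simp: dist_norm norm_minus_commute)
    moreover have "\<phi> x - \<phi> x1 = \<psi> x - \<psi> x1 + \<mu> *\<^sub>R (x - x1)" for x
      by (simp add: \<phi>_def algebra_simps)
    ultimately show ?thesis by simp
  qed
  ultimately show ?thesis
    using x1 C by (intro bexI[of _ x1] exI[of _ \<mu>] conjI exI[of _ r0]) auto
qed

end
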